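(* Let $M$ be a matroid with set of circuits $\mathcal{C}(M)$ and set of cocircuits $\mathcal{C}^*(M)$. Introduce variables $a_{e,X}$ for each pair $X\in\mathcal{C}(M)$, $e\in X$, and variables $b_{e,Y}$ for each pair $Y\in\mathcal{C}^*(M)$, $e\in Y$. Consider the linear system over $F_2$ consisting of the equations $$a_{e,X}+b_{e,Y}+a_{f,X}+b_{f,Y}+1=0$$ for every $X\in\mathcal{C}(M)$ and $Y\in\mathcal{C}^*(M)$ with $X\cap Y=\{e,f\}$ (with $e\ne f$). Then $M$ is weakly-orientable if and only if this linear system has a solution over $F_2$.
   Context: A signed subset of a finite set $E$ is a pair $Z=(Z^+,Z^-)$ of disjoint subsets of $E$; write $-Z=(Z^-,Z^+)$ and $\underline{Z}=Z^+\cup Z^-$. Two signed subsets $X,Y$ are orthogonal if $(X^+\cap Y^+)\cup(X^-\cap Y^-)\neq\varnothing \iff (X^+\cap Y^-)\cup(X^-\cap Y^+)\neq\varnothing$. A matroid $M$ is weakly-orientable if there exist collections $\mathscr{O},\mathscr{O}^*$ of signed subsets of $E(M)$ such that $-\mathscr{O}=\mathscr{O}$, $-\mathscr{O}^*=\mathscr{O}^*$, whenever $X,Z\in\mathscr{O}$ with $\underline{Z}\subseteq\underline{X}$ then $Z=\pm X$ (and likewise for $\mathscr{O}^*$), $\{\underline{X}: X\in\mathscr{O}\}=\mathcal{C}(M)$, $\{\underline{Y}:Y\in\mathscr{O}^*\}=\mathcal{C}^*(M)$, and every $X\in\mathscr{O}$, $Y\in\mathscr{O}^*$ with $|\underline{X}\cap\underline{Y}|=2$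 are orthogonal. *)

theory Defs
  imports "HOL-Library.Z2"
begin

locale matroid =
  fixes E :: "'a set" and indep :: "'a set \<Rightarrow> bool"
  assumes finite_ground: "finite E"
    and indep_subset_ground: "indep X \<Longrightarrow> X \<subseteq> E"
    and indep_empty: "indep {}"
    and indep_subset: "indep X \<Longrightarrow> Y \<subseteq> X \<Longrightarrow> indep Y"
    and augment: "indep X \<Longrightarrow> indep Y \<Longrightarrow> card X < card Y \<Longrightarrow> \<exists>y\<in>Y - X. indep (insert y X)"

definition bases :: "('a set \<Rightarrow> bool) \<Rightarrow> 'a set set" where
  "bases indep = {B. indep B \<and> (\<forall>B'. indep B' \<longrightarrow> B \<subseteq> B' \<longrightarrow> B' = B)}"

definition circuits :: "'a set \<Rightarrow> ('a set \<Rightarrow> bool) \<Rightarrow> 'a set set" where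
  "circuits E indep = {C. C \<subseteq> E \<and> \<not> indep C \<and> (\<forall>D. D \<subset> C \<longrightarrow> indep D)}"

text \<open>The bases of the dual matroid are the complements of the bases.\<close>

definition dual_indep :: "'a set \<Rightarrow> ('a set \<Rightarrow> bool) \<Rightarrow> 'a set \<Rightarrow> bool" where
  "dual_indep E indep X \<longleftrightarrow> (\<exists>B\<in>bases indep. X \<subseteq> E - B)"

definition cocircuits :: "'a set \<Rightarrow> ('a set \<Rightarrow> bool) \<Rightarrow> 'a set set" where
  "cocircuits E indep = circuits E (dual_indep E indep)"

text \<open>The signed subset \<open>Z = (Z\<^sup>+, Z\<^sup>-)\<close> is encoded as a pair.\<close>

type_synonym 'a signed = "'a set \<times> 'a set"

definition signed_subset :: "'a set \<Rightarrow> 'a signed \<Rightarrow> bool" where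
  "signed_subset E Z \<longleftrightarrow> fst Z \<subseteq> E \<and> snd Z \<subseteq> E \<and> fst Z \<inter> snd Z = {}"

definition sneg :: "'a signed \<Rightarrow> 'a signed" where
  "sneg Z = (snd Z, fst Z)"

definition supp :: "'a signed \<Rightarrow> 'a set" where
  "supp Z = fst Z \<union> snd Z"

definition orthogonal :: "'a signed \<Rightarrow> 'a signed \<Rightarrow> bool" where
  "orthogonal X Y \<longleftrightarrow>
     ((fst X \<inter> fst Y) \<union> (snd X \<inter> snd Y) \<noteq> {} \<longleftrightarrow> (fst X \<inter> snd Y) \<union> (snd X \<inter> fst Y) \<noteq> {})"

definition circuit_signature :: "'a set \<Rightarrow> 'a set set \<Rightarrow> 'a signed set \<Rightarrow> bool" where
  "circuit_signature E \<C> \<O> \<longleftrightarrow>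
     (\<forall>Z\<in>\<O>. signed_subset E Z) \<and>
     sneg ` \<O> = \<O> \<and>
     (\<forall>X\<in>\<O>. \<forall>Z\<in>\<O>. supp Z \<subseteq> supp X \<longrightarrow> Z = X \<or> Z = sneg X) \<and>
     supp ` \<O> = \<C>"

definition weakly_orientable :: "'a set \<Rightarrow> ('a set \<Rightarrow> bool) \<Rightarrow> bool" where
  "weakly_orientable E indep \<longleftrightarrow>
     (\<exists>\<O> \<O>'. circuit_signature E (circuits E indep) \<O> \<and>
        circuit_signature E (cocircuits E indep) \<O>' \<and>
        (\<forall>X\<in>\<O>. \<forall>Y\<in>\<O>'. card (supp X \<inter> supp Y) = 2 \<longrightarrow> orthogonal X Y))"

text \<open>
  The unknowns \<open>a\<^sub>e\<^sub>,\<^sub>X\<close> and \<open>b\<^sub>e\<^sub>,\<^sub>Y\<close> are the values \<open>a e X\<close> and \<open>b e Y\<close> of total functions.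
  Only values with \<open>e \<in> X\<close>, respectively \<open>e \<in> Y\<close>, occur in the equations.
\<close>

definition solves_system ::
  "'a set \<Rightarrow> ('a set \<Rightarrow> bool) \<Rightarrow> ('a \<Rightarrow> 'a set \<Rightarrow> bit) \<Rightarrow> ('a \<Rightarrow> 'a set \<Rightarrow> bit) \<Rightarrow> bool" where
  "solves_system E indep a b \<longleftrightarrow>
     (\<forall>X\<in>circuits E indep. \<forall>Y\<in>cocircuits E indep. \<forall>e f. e \<noteq> f \<longrightarrow> X \<inter> Y = {e, f} \<longrightarrow>
        a e X + b e Y + a f X + b f Y + 1 = 0)"

end

theory Submission
  imports Defs
begin

text \<open>
  A signed set with support \<open>C\<close> is the same thing as a map \<open>C \<rightarrow> F\<^sub>2\<close>, with \<open>1\<close> standing for the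
  negative sign. If the supports of two signed sets meet in \<open>{e, f}\<close>, orthogonality says that the
  products of the signs at \<open>e\<close> and at \<open>f\<close> are opposite, which is the equation of the system. Since
  negating a signed set adds \<open>1\<close> to both of its terms, the choice of one of the two signed
  sets over each circuit and cocircuit does not matter.
\<close>

text \<open>The value is 0 outside \<open>supp Z\<close> as well, so it records a sign only on the
  support.\<close>

definition neg_bit :: "'a signed \<Rightarrow> 'a \<Rightarrow> bit" where
  "neg_bit Z e = of_bool (e \<in> snd Z)"

definition signed_of :: "('a \<Rightarrow> bit) \<Rightarrow> 'a set \<Rightarrow> 'a signed" where
  "signed_of g C = ({e \<in> C. g e = 0}, {e \<in> C. g e = 1})"

lemma supp_signed_of [simp]: "supp (signed_of g C) = C"
  by (auto simp: supp_def signed_of_def)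

lemma signed_subset_signed_of: "C \<subseteq> E \<Longrightarrow> signed_subset E (signed_of g C)"
  by (auto simp: signed_subset_def signed_of_def)

lemma neg_bit_signed_of: "e \<in> C \<Longrightarrow> neg_bit (signed_of g C) e = g e"
  by (cases "g e") (auto simp: neg_bit_def signed_of_def)

lemma supp_sneg [simp]: "supp (sneg Z) = supp Z"
  by (auto simp: supp_def sneg_def)

lemma sneg_sneg [simp]: "sneg (sneg Z) = Z"
  by (simp add: sneg_def)

lemma signed_subset_sneg: "signed_subset E Z \<Longrightarrow> signed_subset E (sneg Z)"
  by (auto simp: signed_subset_def sneg_def)

lemma orthogonal_sneg_left [simp]: "orthogonal (sneg X) Y \<longleftrightarrow> orthogonal X Y"
  by (auto simp: orthogonal_def sneg_def)

lemma orthogonal_sneg_right [simp]: "orthogonal X (sneg Y) \<longleftrightarrow> orthogonal X Y"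
  by (auto simp: orthogonal_def sneg_def)

text \<open>A common element lies in the first union if its two signs agree and in the second if
  they differ. Since \<open>{e, f}\<close> is nonempty, the unions cannot both be empty, so
  orthogonality means that both cases occur: \<open>neg_bit X + neg_bit Y\<close> takes different
  values at \<open>e\<close> and \<open>f\<close>.\<close>

lemma orthogonal_iff_neg_bit:
  assumes "signed_subset E X" "signed_subset E Y" "supp X \<inter> supp Y = {e, f}"
  shows "orthogonal X Y \<longleftrightarrow>
    neg_bit X e + neg_bit Y e + neg_bit X f + neg_bit Y f + 1 = 0"
proof -
  \<comment> \<open>On the common support every element has exactly one sign in each set, so
    \<open>fst\<close> can be eliminated in favour of \<open>snd\<close>.\<close>
  have fst_iff: "x \<in> fst X \<longleftrightarrow> x \<notin> snd X" "x \<in> fst Y \<longleftrightarrow> x \<notin> snd Y" if "x \<in> {e, f}" for x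
    using assms that unfolding signed_subset_def supp_def by blast+
  have eq: "(fst X \<inter> fst Y) \<union> (snd X \<inter> snd Y) \<noteq> {} \<longleftrightarrow>
      (\<exists>x\<in>{e, f}. x \<in> snd X \<longleftrightarrow> x \<in> snd Y)"
    using fst_iff assms(3) unfolding supp_def by blast
  have neq: "(fst X \<inter> snd Y) \<union> (snd X \<inter> fst Y) \<noteq> {} \<longleftrightarrow>
      (\<exists>x\<in>{e, f}. \<not> (x \<in> snd X \<longleftrightarrow> x \<in> snd Y))"
    using fst_iff assms(3) unfolding supp_def by blast
  show ?thesis
    unfolding orthogonal_def eq neq neg_bit_def
    by (cases "e \<in> snd X"; cases "e \<in> snd Y"; cases "f \<in> snd X"; cases "f \<in> snd Y") auto
qed

lemma circuits_subset_eq: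
  "C \<in> circuits E indep \<Longrightarrow> D \<in> circuits E indep \<Longrightarrow> C \<subseteq> D \<Longrightarrow> C = D"
  unfolding circuits_def by blast

text \<open>Closure under negation is built in by adding all negatives. Uniqueness up to sign holds
  because circuits form an antichain, so nested supports coincide.\<close>

lemma circuit_signature_signed_of:
  fixes g :: "'a \<Rightarrow> 'a set \<Rightarrow> bit"
  defines "s \<equiv> \<lambda>C. signed_of (\<lambda>e. g e C) C"
  shows "circuit_signature E (circuits E indep)
    (s ` circuits E indep \<union> (sneg \<circ> s) ` circuits E indep)"
proof -
  let ?\<C> = "circuits E indep"
  have supp_s: "supp (s C) = C" for C
    by (simp add: s_def)
  have "signed_subset E (s C)" if "C \<in> ?\<C>" for C
    using that by (simp add: s_def circuits_def signed_subset_signed_of)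
  then have signed: "\<forall>Z \<in> s ` ?\<C> \<union> (sneg \<circ> s) ` ?\<C>. signed_subset E Z"
    by (auto simp: signed_subset_sneg)
  have negs: "sneg ` (s ` ?\<C> \<union> (sneg \<circ> s) ` ?\<C>) = s ` ?\<C> \<union> (sneg \<circ> s) ` ?\<C>"
    by (auto simp: image_Un image_comp comp_def)
  have supps: "supp ` (s ` ?\<C> \<union> (sneg \<circ> s) ` ?\<C>) = ?\<C>"
    by (auto simp: image_Un image_comp comp_def supp_s)
  have unique: "Z = X \<or> Z = sneg X"
    if XZ: "X \<in> s ` ?\<C> \<union> (sneg \<circ> s) ` ?\<C>" "Z \<in> s ` ?\<C> \<union> (sneg \<circ> s) ` ?\<C>"
      and sub: "supp Z \<subseteq> supp X" for X Z
  proof -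
    obtain C where C: "C \<in> ?\<C>" "X = s C \<or> X = sneg (s C)"
      using XZ(1) by auto
    obtain D where D: "D \<in> ?\<C>" "Z = s D \<or> Z = sneg (s D)"
      using XZ(2) by auto
    have "D \<subseteq> C"
      using sub C(2) D(2) by (auto simp: supp_s)
    then have "D = C"
      by (rule circuits_subset_eq[OF D(1) C(1)])
    then show ?thesis
      using C(2) D(2) by auto
  qed
  show ?thesis
    unfolding circuit_signature_def by (intro conjI ballI impI signed negs supps unique)
qed

text \<open>Fixes one signed set over each support, from which the values of the unknowns can be
  read off.\<close>

lemma circuit_signature_selector:
  assumes "circuit_signature E \<C> \<O>"
  obtains s where "\<And>C. C \<in> \<C> \<Longrightarrow> s C \<in> \<O> \<and> supp (s C) = C \<and> signed_subset E (s C)"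
proof -
  have "\<forall>C\<in>\<C>. \<exists>Z. Z \<in> \<O> \<and> supp Z = C \<and> signed_subset E Z"
    using assms unfolding circuit_signature_def by blast
  then show ?thesis
    using that by metis
qed

lemma weakly_orientable_imp_solvable:
  assumes "weakly_orientable E indep"
  shows "\<exists>a b. solves_system E indep a b"
proof -
  obtain \<O> \<O>' where O: "circuit_signature E (circuits E indep) \<O>"
      "circuit_signature E (cocircuits E indep) \<O>'"
    and orth: "\<And>X Y. X \<in> \<O> \<Longrightarrow> Y \<in> \<O>' \<Longrightarrow> card (supp X \<inter> supp Y) = 2 \<Longrightarrow> orthogonal X Y"
    using assms unfolding weakly_orientable_def by blast
  obtain s where s: "\<And>C. C \<in> circuits E indep \<Longrightarrow>
      s C \<in> \<O> \<and> supp (s C) = C \<and> signed_subset E (s C)"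
    using circuit_signature_selector[OF O(1)] by blast
  obtain t where t: "\<And>C. C \<in> cocircuits E indep \<Longrightarrow>
      t C \<in> \<O>' \<and> supp (t C) = C \<and> signed_subset E (t C)"
    using circuit_signature_selector[OF O(2)] by blast
  have "solves_system E indep (\<lambda>e X. neg_bit (s X) e) (\<lambda>e Y. neg_bit (t Y) e)"
    unfolding solves_system_def
  proof (intro ballI allI impI)
    fix X Y e f
    assume X: "X \<in> circuits E indep" and Y: "Y \<in> cocircuits E indep"
      and ef: "e \<noteq> f" "X \<inter> Y = {e, f}"
    \<comment> \<open>Here \<open>e \<noteq> f\<close> gives the intersection the cardinality 2 that
      \<open>orth\<close> asks for.\<close>
    have "orthogonal (s X) (t Y)"
      using orth[of "s X" "t Y"] s[OF X] t[OF Y] ef by simp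
    then show "neg_bit (s X) e + neg_bit (t Y) e + neg_bit (s X) f + neg_bit (t Y) f + 1 = 0"
      using orthogonal_iff_neg_bit[of E "s X" "t Y" e f] s[OF X] t[OF Y] ef by simp
  qed
  then show ?thesis
    by blast
qed

text \<open>The solution is read as a choice of signs on each circuit and cocircuit;
  \<open>signed_of\<close> discards the values at elements outside them.\<close>

lemma solvable_imp_weakly_orientable:
  assumes "solves_system E indep a b"
  shows "weakly_orientable E indep"
proof -
  define s where "s = (\<lambda>C. signed_of (\<lambda>e. a e C) C)"
  define t where "t = (\<lambda>C. signed_of (\<lambda>e. b e C) C)"
  let ?\<O> = "s ` circuits E indep \<union> (sneg \<circ> s) ` circuits E indep"
  let ?\<O>' = "t ` cocircuits E indep \<union> (sneg \<circ> t) ` cocircuits E indep"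
  have orth: "orthogonal (s X) (t Y)"
    if X: "X \<in> circuits E indep" and Y: "Y \<in> cocircuits E indep" and "card (X \<inter> Y) = 2" for X Y
  proof -
    obtain e f where ef: "X \<inter> Y = {e, f}" "e \<noteq> f"
      using \<open>card (X \<inter> Y) = 2\<close> by (meson card_2_iff)
    then have mem: "e \<in> X" "e \<in> Y" "f \<in> X" "f \<in> Y"
      by auto
    have "X \<subseteq> E" "Y \<subseteq> E"
      using X Y by (auto simp: circuits_def cocircuits_def)
    then have "orthogonal (s X) (t Y) \<longleftrightarrow> a e X + b e Y + a f X + b f Y + 1 = 0"
      using orthogonal_iff_neg_bit[of E "s X" "t Y" e f] ef mem
      by (simp add: s_def t_def signed_subset_signed_of neg_bit_signed_of)
    then show ?thesis
      using assms X Y ef unfolding solves_system_def by blast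
  qed
  have "circuit_signature E (circuits E indep) ?\<O>"
    unfolding s_def by (rule circuit_signature_signed_of)
  \<comment> \<open>Cocircuits are by definition the circuits for \<open>dual_indep E indep\<close>,
    so the same lemma applies.\<close>
  moreover have "circuit_signature E (cocircuits E indep) ?\<O>'"
    unfolding t_def cocircuits_def by (rule circuit_signature_signed_of)
  \<comment> \<open>All four sign combinations reduce to \<open>orth\<close>, as negation affects
    neither supports nor orthogonality.\<close>
  moreover have "\<forall>X\<in>?\<O>. \<forall>Y\<in>?\<O>'. card (supp X \<inter> supp Y) = 2 \<longrightarrow> orthogonal X Y"
    using orth by (auto simp: s_def t_def)
  ultimately show ?thesis
    unfolding weakly_orientable_def by blast
qed

theorem theorem2p7:
  fixes E :: "'a set" and indep :: "'a set \<Rightarrow> bool"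
  assumes "matroid E indep"
  shows "weakly_orientable E indep \<longleftrightarrow>
    (\<exists>a b :: 'a \<Rightarrow> 'a set \<Rightarrow> bit. solves_system E indep a b)"
  using weakly_orientable_imp_solvable solvable_imp_weakly_orientable by blast

end
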